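(* The centroids of $m$-gons under the midpoint iteration are invariant after the first step for $m=1,2,3,4$; that is, for every $m$-gon $v\in\mathbb C^m$, $G(M^nv)=G(Mv)$ for all $n\ge 1$. For $m=5$ and for every $m\ge 7$, there are instances (that is, $m$-gons $v\in\mathbb C^m$) in which no two of the iterated centroids $G(M^nv)$ are colinear with their limit point $\lim_{n\to\infty}G(M^nv)$. (In particular, they are not eventually colinear.)
   Context: The plane is identified with $\mathbb C$. For an integer $m\ge1$, an $m$-gon is any vector $v=(v_0,\dots,v_{m-1})\in\mathbb C^m$, whose entries are its vertices in cyclic order; no convexity, simplicity, or non-degeneracy assumptions are imposed. Indices are understood modulo $m$. The midpoint map $M:\mathbb C^m\to\mathbb C^m$, which joins the midpoints of consecutive edges, is $(Mv)_k=\frac12(v_k+v_{k+1})$, and $M^n$ is its $n$-th iterate. The centroid $G(v)\in\mathbb C$ of an $m$-gon $v$ is defined algebraically by the standard formula $$G(v)=\frac{Z(v)}{6A(v)},\qquad A(v)=\frac12\sum_{k=0}^{m-1}\operatorname{Im}(\bar v_kv_{k+1}),\qquad Z(v)=\sum_{k=0}^{m-1}(v_k+v_{k+1})\operatorname{Im}(\bar v_kv_{k+1}),$$ where $A(v)\in\mathbb R$ is the signed area of $v$. For simple polygons this is the centroid of the filled polygon, and the formula is applied to arbitrary polygons. *)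

theory Defs
  imports "HOL-Analysis.Analysis" "Jordan_Normal_Form.Matrix"
begin

(* HOL-Analysis uses the same infix for its type-indexed vectors. *)
unbundle no vec_syntax

(* An m-gon is an element of carrier_vec m :: complex vec set. The number m of vertices is
   recovered as dim_vec v; the vertices are v $ 0, ..., v $ (m - 1), indices taken modulo m. *)

definition midpoint_map :: "complex vec \<Rightarrow> complex vec" where
  "midpoint_map v = vec (dim_vec v) (\<lambda>k. (v $ k + v $ (Suc k mod dim_vec v)) / 2)"

definition signed_area :: "complex vec \<Rightarrow> real" where
  "signed_area v = (1 / 2) * (\<Sum>k<dim_vec v. Im (cnj (v $ k) * v $ (Suc k mod dim_vec v)))"

definition centroid_numerator :: "complex vec \<Rightarrow> complex" where
  "centroid_numerator v =
     (\<Sum>k<dim_vec v. (v $ k + v $ (Suc k mod dim_vec v)) *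
        complex_of_real (Im (cnj (v $ k) * v $ (Suc k mod dim_vec v))))"

(* The centroid is meaningful only if signed_area v is nonzero; otherwise the value below is 0,
   by the convention x / 0 = 0. *)
definition centroid :: "complex vec \<Rightarrow> complex" where
  "centroid v = centroid_numerator v / (6 * complex_of_real (signed_area v))"

end

theory Submission
  imports Defs
begin

text \<open>
  For at most two vertices the signed area vanishes identically. The midpoint triangle has the same
  vertex mean as the triangle, and the midpoint polygon of a quadrilateral is a parallelogram with
  the same centre as its own midpoint polygon; in both shapes the centroid is the mean of the
  vertices, and an iteration step only multiplies the area by a nonzero constant.

  For more vertices the discrete Fourier transform diagonalises the midpoint map. With
  \<open>\<omega> = exp (2 \<pi> i / m)\<close>, the mode \<open>\<omega> ^ (j k)\<close> has the eigenvalue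
  \<open>(1 + \<omega> ^ j) / 2 = cos (\<pi> j / m) exp (\<pi> i j / m)\<close>. The area is a diagonal quadratic form in the Fourier
  coefficients \<open>c j\<close>, while the centroid numerator is a sum of cubic terms \<open>c a * c b * cnj (c d)\<close>
  over the resonant triples \<open>a + b = d\<close> modulo \<open>m\<close>, with real weights. For such a triple the phases
  of the eigenvalues cancel up to sign, so every cubic term is multiplied by a real number at each step.
  A single resonance thus moves the centroid on a line through its limit. Two resonances whose
  real multipliers have different moduli, and whose coefficients are linearly independent over the
  reals, force any two centroids out of line with the limit.

  Modes 1, 2, 3 with coefficients 1, 1, \<open>\<i>\<close> provide this. Put \<open>x = \<pi> / m\<close>. The resonance
  \<open>1 + 1 = 2\<close> has the multiplier \<open>cos x * cos x * cos (2 x)\<close>, the resonance \<open>1 + 2 = 3\<close> the multiplier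
  \<open>cos x * cos (2 x) * cos (3 x)\<close>, and the ratio of the second to the first is
  \<open>cos (3 x) / cos x = 2 cos (2 x) - 1\<close>. This lies strictly between -1 and 1 for \<open>m \<ge> 5\<close>, and it
  vanishes only for \<open>m = 6\<close>, which is why the hexagon is excluded. For \<open>m = 5\<close> there is one more resonance,
  \<open>3 + 3 = 1\<close> modulo 5; modes 2 and 3 are then complex conjugate, so it has the same multiplier as
  \<open>1 + 2 = 3\<close>, and its coefficient is real, so the independence is not disturbed. The area is bounded below by the
  contribution of mode 1, which decays like \<open>(cos x)\<^sup>2\<close> per step; hence the centroids tend to 0 at
  the rate \<open>cos (2 x)\<close>.
\<close>

section \<open>Polygons with at most four vertices\<close>

lemma dim_midpoint_map [simp]: "dim_vec (midpoint_map v) = dim_vec v"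
  by (simp add: midpoint_map_def)

lemma dim_midpoint_iterate [simp]: "dim_vec ((midpoint_map ^^ n) v) = dim_vec v"
  by (induction n) simp_all

lemma index_midpoint_map [simp]:
  "k < dim_vec v \<Longrightarrow> midpoint_map v $ k = (v $ k + v $ (Suc k mod dim_vec v)) / 2"
  by (simp add: midpoint_map_def)

text \<open>The common pattern for triangles and parallelograms: if on some class of polygons the centroid
  is a multiple of a point \<open>c\<close> that the midpoint map preserves, then the centroid does not move.
  Since \<open>t\<close> is nonzero, a zero area stays zero and a nonzero one nonzero, so that the default
  value of the division by zero is constant as well.\<close>

lemma centroid_iterates_const:
  fixes t :: real and c :: "complex vec \<Rightarrow> complex"
  assumes "t \<noteq> 0" and "P v"
    and centre: "\<And>w. P w \<Longrightarrow> centroid_numerator w = c w * signed_area w"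
    and step: "\<And>w. P w \<Longrightarrow> P (midpoint_map w) \<and> c (midpoint_map w) = c w \<and>
                 signed_area (midpoint_map w) = t * signed_area w"
  shows "(signed_area ((midpoint_map ^^ n) v) = 0 \<longleftrightarrow> signed_area v = 0) \<and>
         centroid ((midpoint_map ^^ n) v) = centroid v"
proof -
  have "P ((midpoint_map ^^ n) v) \<and> c ((midpoint_map ^^ n) v) = c v \<and>
        signed_area ((midpoint_map ^^ n) v) = t ^ n * signed_area v"
    by (induction n) (use \<open>P v\<close> step in auto)
  then show ?thesis
    using \<open>t \<noteq> 0\<close> \<open>P v\<close> by (simp add: centroid_def centre)
qed

lemma signed_area_le_2: "dim_vec v \<le> 2 \<Longrightarrow> signed_area v = 0"
proof -
  assume "dim_vec v \<le> 2"
  then consider "dim_vec v = 0" | "dim_vec v = 1" | "dim_vec v = 2"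
    by linarith
  then show ?thesis
    by cases (simp_all add: signed_area_def numeral_2_eq_2 algebra_simps)
qed

lemma lessThan_3: "{..<3::nat} = {0, 1, 2}" and lessThan_4: "{..<4::nat} = {0, 1, 2, 3}"
  by auto

lemma signed_area_3:
  "dim_vec v = 3 \<Longrightarrow> signed_area v =
     (Im (cnj (v $ 0) * v $ 1) + Im (cnj (v $ 1) * v $ 2) + Im (cnj (v $ 2) * v $ 0)) / 2"
  by (simp add: signed_area_def lessThan_3 del: One_nat_def)

lemma centroid_numerator_3:
  "dim_vec v = 3 \<Longrightarrow> centroid_numerator v =
     (v $ 0 + v $ 1) * Im (cnj (v $ 0) * v $ 1) + (v $ 1 + v $ 2) * Im (cnj (v $ 1) * v $ 2) +
     (v $ 2 + v $ 0) * Im (cnj (v $ 2) * v $ 0)"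
  by (simp add: centroid_numerator_def lessThan_3 del: One_nat_def)

lemma signed_area_4:
  "dim_vec v = 4 \<Longrightarrow> signed_area v =
     (Im (cnj (v $ 0) * v $ 1) + Im (cnj (v $ 1) * v $ 2) + Im (cnj (v $ 2) * v $ 3) +
      Im (cnj (v $ 3) * v $ 0)) / 2"
  by (simp add: signed_area_def lessThan_4 del: One_nat_def)

lemma centroid_numerator_4:
  "dim_vec v = 4 \<Longrightarrow> centroid_numerator v =
     (v $ 0 + v $ 1) * Im (cnj (v $ 0) * v $ 1) + (v $ 1 + v $ 2) * Im (cnj (v $ 1) * v $ 2) +
     (v $ 2 + v $ 3) * Im (cnj (v $ 2) * v $ 3) + (v $ 3 + v $ 0) * Im (cnj (v $ 3) * v $ 0)"
  by (simp add: centroid_numerator_def lessThan_4 del: One_nat_def)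

text \<open>The linear dependence of three vectors in the plane, with coefficients from Cramer's rule. It is
  what turns the centroid formula of a triangle or a parallelogram into the mean of the vertices.\<close>

lemma cross_product_cyclic_sum:
  fixes a b c :: complex
  shows "c * Im (cnj a * b) + a * Im (cnj b * c) + b * Im (cnj c * a) = 0"
  by (simp add: complex_eq_iff algebra_simps)

lemma centroid_numerator_triangle:
  assumes "dim_vec v = 3"
  shows "centroid_numerator v = 2 * (v $ 0 + v $ 1 + v $ 2) * signed_area v"
proof -
  define a b c where "a = v $ 0" and "b = v $ 1" and "c = v $ 2"
  define x y z where "x = Im (cnj a * b)" and "y = Im (cnj b * c)" and "z = Im (cnj c * a)"
  have "centroid_numerator v = (a + b) * x + (b + c) * y + (c + a) * z"
    unfolding centroid_numerator_3[OF assms] a_def b_def c_def x_def y_def z_def ..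
  also have "\<dots> = (a + b + c) * of_real (x + y + z) - (c * x + a * y + b * z)"
    by (simp add: algebra_simps)
  also have "c * x + a * y + b * z = 0"
    unfolding x_def y_def z_def by (rule cross_product_cyclic_sum)
  also have "x + y + z = 2 * signed_area v"
    unfolding signed_area_3[OF assms] a_def b_def c_def x_def y_def z_def by (simp del: One_nat_def)
  finally show ?thesis
    by (simp add: a_def b_def c_def)
qed

lemma midpoint_triangle:
  assumes "dim_vec v = 3"
  shows "midpoint_map v $ 0 = (v $ 0 + v $ 1) / 2" "midpoint_map v $ 1 = (v $ 1 + v $ 2) / 2"
    "midpoint_map v $ 2 = (v $ 2 + v $ 0) / 2"
  using assms by (simp_all del: One_nat_def)

lemma signed_area_midpoint_triangle:
  assumes "dim_vec v = 3"
  shows "signed_area (midpoint_map v) = 1/4 * signed_area v"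
  using assms by (simp add: signed_area_3 midpoint_triangle del: One_nat_def) (simp add: field_simps)

definition parallelogram :: "complex vec \<Rightarrow> bool" where
  "parallelogram v \<longleftrightarrow> dim_vec v = 4 \<and> v $ 0 + v $ 2 = v $ 1 + v $ 3"

lemma midpoint_quadrilateral:
  assumes "dim_vec v = 4"
  shows "midpoint_map v $ 0 = (v $ 0 + v $ 1) / 2" "midpoint_map v $ 1 = (v $ 1 + v $ 2) / 2"
    "midpoint_map v $ 2 = (v $ 2 + v $ 3) / 2" "midpoint_map v $ 3 = (v $ 3 + v $ 0) / 2"
  using assms by (simp_all del: One_nat_def)

lemma parallelogram_midpoint_map: "dim_vec v = 4 \<Longrightarrow> parallelogram (midpoint_map v)"
  by (simp add: parallelogram_def midpoint_quadrilateral field_simps del: One_nat_def)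

lemma signed_area_midpoint_parallelogram:
  assumes "parallelogram v"
  shows "signed_area (midpoint_map v) = 1/2 * signed_area v"
proof -
  have dim: "dim_vec v = 4" and v3: "v $ 3 = v $ 0 - v $ 1 + v $ 2"
    using assms by (simp_all add: parallelogram_def algebra_simps del: One_nat_def)
  show ?thesis
    using dim by (simp add: signed_area_4 midpoint_quadrilateral v3 del: One_nat_def) (simp add: field_simps)
qed

lemma centroid_numerator_parallelogram:
  assumes "parallelogram v"
  shows "centroid_numerator v = 3 * (v $ 0 + v $ 2) * signed_area v"
proof -
  have dim: "dim_vec v = 4" and v3: "v $ 3 = v $ 0 - v $ 1 + v $ 2"
    using assms by (simp_all add: parallelogram_def algebra_simps del: One_nat_def)
  define a b c where "a = v $ 0" and "b = v $ 1" and "c = v $ 2"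
  define x y z where "x = Im (cnj a * b)" and "y = Im (cnj b * c)" and "z = Im (cnj c * a)"
  have edges: "Im (cnj c * (a - b + c)) = y + z" "Im (cnj (a - b + c) * a) = x + z"
    by (simp_all add: x_def y_def z_def algebra_simps)
  have "centroid_numerator v =
      (a + b) * x + (b + c) * y + (c + (a - b + c)) * of_real (y + z) + ((a - b + c) + a) * of_real (x + z)"
    unfolding centroid_numerator_4[OF dim] v3 a_def[symmetric] b_def[symmetric] c_def[symmetric] edges
    by (simp only: x_def y_def z_def)
  also have "\<dots> = 3 * (a + c) * of_real (x + y + z) - 2 * (c * x + a * y + b * z)"
    by (simp add: algebra_simps)
  also have "c * x + a * y + b * z = 0"
    unfolding x_def y_def z_def by (rule cross_product_cyclic_sum)
  also have "x + y + z = signed_area v"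
    unfolding signed_area_4[OF dim] v3 a_def[symmetric] b_def[symmetric] c_def[symmetric] edges
    unfolding x_def[symmetric] y_def[symmetric] by simp
  finally show ?thesis
    by (simp add: a_def c_def)
qed

proposition centroid_invariant_le_4:
  assumes "m \<in> {1, 2, 3, 4}" and "v \<in> carrier_vec m" and "n \<ge> 1"
  shows "(signed_area ((midpoint_map ^^ n) v) = 0 \<longleftrightarrow> signed_area (midpoint_map v) = 0) \<and>
         centroid ((midpoint_map ^^ n) v) = centroid (midpoint_map v)"
proof -
  have dim: "dim_vec v = m"
    using assms(2) by auto
  obtain n' where n': "n = Suc n'"
    using \<open>n \<ge> 1\<close> by (cases n) auto
  have shift: "(midpoint_map ^^ n) v = (midpoint_map ^^ n') (midpoint_map v)"
    unfolding n' by (simp add: funpow_swap1)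
  from assms(1) consider "m \<le> 2" | "m = 3" | "m = 4"
    by auto
  then show ?thesis
  proof cases
    case 1
    then show ?thesis
      by (simp add: centroid_def signed_area_le_2 dim)
  next
    case 2
    show ?thesis
      unfolding shift
      by (rule centroid_iterates_const[where t = "1/4" and P = "\<lambda>w. dim_vec w = 3"
            and c = "\<lambda>w. 2 * (w $ 0 + w $ 1 + w $ 2)"])
         (simp_all add: 2 dim signed_area_midpoint_triangle centroid_numerator_triangle
            midpoint_triangle add_divide_distrib del: One_nat_def)
  next
    case 3
    have quad: "dim_vec w = 4" "w $ 1 + w $ 3 = w $ 0 + w $ 2" if "parallelogram w" for w
      using that by (simp_all add: parallelogram_def del: One_nat_def)
    have centre: "midpoint_map w $ 0 + midpoint_map w $ 2 = w $ 0 + w $ 2" if "parallelogram w" for w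
    proof -
      have "midpoint_map w $ 0 + midpoint_map w $ 2 = ((w $ 0 + w $ 2) + (w $ 1 + w $ 3)) / 2"
        using quad(1)[OF that] by (simp add: midpoint_quadrilateral field_simps del: One_nat_def)
      also have "\<dots> = w $ 0 + w $ 2"
        unfolding quad(2)[OF that] by (simp add: field_simps)
      finally show ?thesis .
    qed
    show ?thesis
      unfolding shift
      by (rule centroid_iterates_const[where t = "1/2" and P = parallelogram
            and c = "\<lambda>w. 3 * (w $ 0 + w $ 2)"])
         (simp_all add: 3 dim quad centre parallelogram_midpoint_map
            signed_area_midpoint_parallelogram centroid_numerator_parallelogram
            del: index_midpoint_map)
  qed
qed

section \<open>Polygons as sums of Fourier modes\<close>

text \<open>The frequency \<open>j\<close> is kept as an index, and not as an exponent of one primitive root, because the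
  resonance condition below compares frequencies modulo \<open>m\<close>.\<close>

definition unity_root :: "nat \<Rightarrow> nat \<Rightarrow> complex" where
  "unity_root m j = cis (2 * pi * real j / real m)"

lemma unity_root_ne_0 [simp]: "unity_root m j \<noteq> 0"
  by (simp add: unity_root_def)

lemma unity_root_add: "unity_root m (a + b) = unity_root m a * unity_root m b"
  by (simp add: unity_root_def cis_mult add_divide_distrib distrib_left)

lemma cnj_unity_root: "cnj (unity_root m j) = inverse (unity_root m j)"
  by (simp add: unity_root_def cis_cnj)

lemma Im_unity_root: "Im (unity_root m j) = sin (2 * pi * real j / real m)"
  by (simp add: unity_root_def)

lemma unity_root_power_period: "unity_root m j ^ m = 1"
proof (cases "m = 0")
  case False
  have "unity_root m j ^ m = cis (real m * (2 * pi * real j / real m))"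
    by (simp only: unity_root_def Complex.DeMoivre)
  also have "real m * (2 * pi * real j / real m) = 2 * pi * real j"
    using False by simp
  finally show ?thesis
    by (simp add: cis_multiple_2pi)
qed simp

lemma unity_root_power_mod: "unity_root m j ^ (k mod m) = unity_root m j ^ k"
proof -
  have "unity_root m j ^ k = unity_root m j ^ (m * (k div m) + k mod m)"
    by simp
  also have "\<dots> = unity_root m j ^ (k mod m)"
    unfolding power_add power_mult unity_root_power_period by simp
  finally show ?thesis ..
qed

lemma unity_root_eq_iff:
  assumes "m > 0"
  shows "unity_root m a = unity_root m b \<longleftrightarrow> a mod m = b mod m"
  using complex_root_unity_eq[of m a b] assms
  by (simp add: unity_root_def cis_conv_exp mult_ac)

text \<open>Orthogonality of the characters of the cyclic group: the only source of the resonance conditions.\<close>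

lemma sum_character:
  assumes "m > 0"
  shows "(\<Sum>k<m. (unity_root m a * cnj (unity_root m b)) ^ k) =
         (if a mod m = b mod m then of_nat m else 0)"
proof -
  let ?x = "unity_root m a * cnj (unity_root m b)"
  have eq1: "?x = 1 \<longleftrightarrow> a mod m = b mod m"
    using unity_root_eq_iff[OF assms, of a b] by (simp add: cnj_unity_root field_simps)
  have "?x ^ m = 1"
    using unity_root_power_period[of m]
    by (simp add: power_mult_distrib flip: complex_cnj_power)
  then have "?x \<noteq> 1 \<Longrightarrow> (\<Sum>k<m. ?x ^ k) = 0"
    by (simp add: geometric_sum)
  moreover have "?x = 1 \<Longrightarrow> (\<Sum>k<m. ?x ^ k) = of_nat m"
    by simp
  ultimately show ?thesis
    using eq1 by auto
qed

definition fourier_polygon :: "nat \<Rightarrow> nat set \<Rightarrow> (nat \<Rightarrow> complex) \<Rightarrow> complex vec" where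
  "fourier_polygon m J c = vec m (\<lambda>k. \<Sum>j\<in>J. c j * unity_root m j ^ k)"

lemma dim_fourier_polygon [simp]: "dim_vec (fourier_polygon m J c) = m"
  by (simp add: fourier_polygon_def)

lemma index_fourier_polygon:
  "k < m \<Longrightarrow> fourier_polygon m J c $ k = (\<Sum>j\<in>J. c j * unity_root m j ^ k)"
  by (simp add: fourier_polygon_def)

text \<open>Averaging the mode \<open>j\<close> over neighbouring vertices multiplies it by this number.\<close>

definition midpoint_eigenvalue :: "nat \<Rightarrow> nat \<Rightarrow> complex" where
  "midpoint_eigenvalue m j = (1 + unity_root m j) / 2"

lemma midpoint_map_fourier_polygon:
  "midpoint_map (fourier_polygon m J c) =
   fourier_polygon m J (\<lambda>j. c j * midpoint_eigenvalue m j)"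
proof (rule eq_vecI)
  fix k assume "k < dim_vec (fourier_polygon m J (\<lambda>j. c j * midpoint_eigenvalue m j))"
  then have "k < m" by simp
  then have "midpoint_map (fourier_polygon m J c) $ k =
      ((\<Sum>j\<in>J. c j * unity_root m j ^ k) + (\<Sum>j\<in>J. c j * unity_root m j ^ Suc k)) / 2"
    by (simp add: index_fourier_polygon unity_root_power_mod del: power_Suc)
  also have "\<dots> = (\<Sum>j\<in>J. c j * midpoint_eigenvalue m j * unity_root m j ^ k)"
    unfolding sum.distrib[symmetric] sum_divide_distrib
    by (rule sum.cong) (simp_all add: midpoint_eigenvalue_def field_simps)
  finally show "midpoint_map (fourier_polygon m J c) $ k =
      fourier_polygon m J (\<lambda>j. c j * midpoint_eigenvalue m j) $ k"
    using \<open>k < m\<close> by (simp add: index_fourier_polygon)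
qed simp

lemma midpoint_iterate_fourier_polygon:
  "(midpoint_map ^^ n) (fourier_polygon m J c) =
   fourier_polygon m J (\<lambda>j. c j * midpoint_eigenvalue m j ^ n)"
  by (induction n) (simp_all add: midpoint_map_fourier_polygon mult_ac)

text \<open>Orthogonality leaves only the diagonal terms. Frequencies below \<open>m\<close> are pairwise incongruent,
  so that no two modes coincide.\<close>

lemma signed_area_fourier_polygon:
  assumes J: "J \<subseteq> {..<m}"
  shows "signed_area (fourier_polygon m J c) =
         m / 2 * (\<Sum>j\<in>J. (cmod (c j))\<^sup>2 * sin (2 * pi * real j / real m))"
proof (cases "m = 0")
  case False
  then have "m > 0" by simp
  define u where "u = unity_root m"
  have fin: "finite J"
    using J finite_subset by blast
  \<comment> \<open>The imaginary part is taken after the summation: the sum of the products is diagonal already.\<close>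
  have "(\<Sum>k<m. cnj (fourier_polygon m J c $ k) * fourier_polygon m J c $ (Suc k mod m)) =
        (\<Sum>k<m. \<Sum>a\<in>J. \<Sum>b\<in>J. cnj (c a) * c b * u b * (u b * cnj (u a)) ^ k)"
    by (intro sum.cong refl)
       (simp add: index_fourier_polygon unity_root_power_mod u_def sum_product power_mult_distrib mult_ac)
  also have "\<dots> = (\<Sum>a\<in>J. \<Sum>b\<in>J. \<Sum>k<m. cnj (c a) * c b * u b * (u b * cnj (u a)) ^ k)"
    by (rule trans[OF sum.swap sum.cong[OF refl sum.swap]])
  also have "\<dots> = (\<Sum>a\<in>J. \<Sum>b\<in>J. cnj (c a) * c b * u b * (if b = a then of_nat m else 0))"
    unfolding sum_distrib_left[symmetric]
  proof (intro sum.cong refl)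
    fix a b assume "a \<in> J" "b \<in> J"
    then have "b mod m = a mod m \<longleftrightarrow> b = a"
      using J by (simp add: subset_eq)
    then show "cnj (c a) * c b * u b * (\<Sum>k<m. (u b * cnj (u a)) ^ k) =
        cnj (c a) * c b * u b * (if b = a then of_nat m else 0)"
      using sum_character[OF \<open>m > 0\<close>, of b a] by (simp add: u_def)
  qed
  also have "\<dots> = (\<Sum>a\<in>J. of_real (m * (cmod (c a))\<^sup>2) * u a)"
    using fin by (intro sum.cong refl)
      (simp add: if_distrib sum.delta cong: if_cong, simp add: complex_norm_square mult_ac flip: of_real_power)
  finally have "Im (\<Sum>k<m. cnj (fourier_polygon m J c $ k) * fourier_polygon m J c $ (Suc k mod m)) =
      (\<Sum>a\<in>J. m * (cmod (c a))\<^sup>2 * sin (2 * pi * real a / real m))"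
    by (simp only: Im_sum Im_complex_of_real Im_unity_root u_def times_complex.sel Re_complex_of_real) simp
  then show ?thesis
    unfolding signed_area_def dim_fourier_polygon Im_sum
    by (simp add: sum_distrib_left mult_ac)
qed (simp add: signed_area_def)

lemma of_real_Im: "complex_of_real (Im z) = (z - cnj z) / (2 * \<i>)"
  by (simp add: complex_eq_iff)

text \<open>Each term of the numerator is a product of two vertices and a conjugate vertex, so orthogonality
  retains the triples with \<open>a + b\<close> congruent to \<open>d\<close>. The reality of the weights is essential later:
  the direction of a cubic term in the plane is determined by the coefficients alone.\<close>

lemma centroid_numerator_fourier_polygon:
  fixes m :: nat and c :: "nat \<Rightarrow> complex"
  defines "\<sigma> \<equiv> \<lambda>j. sin (2 * pi * real j / real m)"
  shows "centroid_numerator (fourier_polygon m J c) =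
         m * (\<Sum>a\<in>J. \<Sum>b\<in>J. \<Sum>d\<in>J. if (a + b) mod m = d mod m
                then c a * c b * cnj (c d) * of_real (\<sigma> d + (\<sigma> a + \<sigma> b) / 2) else 0)"
proof (cases "m = 0")
  case False
  then have "m > 0" by simp
  define u where "u = unity_root m"
  define p where "p k = (\<Sum>j\<in>J. c j * u j ^ k)" for k
  define \<delta> where "\<delta> a b d = (if (a + b) mod m = d mod m then complex_of_nat m else 0)" for a b d
  define g where "g a b d = c a * c b * cnj (c d) * \<delta> a b d" for a b d
  define h where "h a b d = (1 + u a) * (u b - cnj (u d)) / (2 * \<i>)" for a b d
  have summand: "(p k + p (Suc k)) * complex_of_real (Im (cnj (p k) * p (Suc k))) =
      (\<Sum>a\<in>J. \<Sum>b\<in>J. \<Sum>d\<in>J. c a * c b * cnj (c d) * h a b d * (u (a + b) * cnj (u d)) ^ k)" for k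
  proof -
    have "p k + p (Suc k) = (\<Sum>a\<in>J. c a * (1 + u a) * u a ^ k)"
      by (simp add: p_def algebra_simps sum.distrib)
    moreover have "cnj (p k) * p (Suc k) - p k * cnj (p (Suc k)) =
        (\<Sum>b\<in>J. \<Sum>d\<in>J. c b * cnj (c d) * (u b - cnj (u d)) * (u b * cnj (u d)) ^ k)"
    proof -
      have "p (Suc k) * cnj (p k) = (\<Sum>b\<in>J. \<Sum>d\<in>J. c b * cnj (c d) * u b * (u b * cnj (u d)) ^ k)"
        unfolding p_def cnj_sum sum_product by (simp add: power_mult_distrib mult_ac)
      then have "cnj (p k) * p (Suc k) = (\<Sum>b\<in>J. \<Sum>d\<in>J. c b * cnj (c d) * u b * (u b * cnj (u d)) ^ k)"
        by (simp only: mult.commute[of "p (Suc k)"])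
      moreover have "p k * cnj (p (Suc k)) =
          (\<Sum>b\<in>J. \<Sum>d\<in>J. c b * cnj (c d) * cnj (u d) * (u b * cnj (u d)) ^ k)"
        unfolding p_def cnj_sum sum_product by (simp add: power_mult_distrib mult_ac)
      ultimately show ?thesis
        by (simp add: sum_subtractf[symmetric] algebra_simps del: power_Suc)
    qed
    ultimately have "(p k + p (Suc k)) * complex_of_real (Im (cnj (p k) * p (Suc k))) =
        (\<Sum>a\<in>J. c a * (1 + u a) * u a ^ k) *
        ((\<Sum>b\<in>J. \<Sum>d\<in>J. c b * cnj (c d) * (u b - cnj (u d)) * (u b * cnj (u d)) ^ k) / (2 * \<i>))"
      by (simp only: of_real_Im complex_cnj_mult complex_cnj_cnj)
    also have "\<dots> = (\<Sum>a\<in>J. \<Sum>b\<in>J. \<Sum>d\<in>J. c a * c b * cnj (c d) * h a b d * (u (a + b) * cnj (u d)) ^ k)"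
      unfolding sum_divide_distrib sum_product unfolding sum_distrib_left
      by (intro sum.cong refl)
         (simp add: h_def u_def unity_root_add power_mult_distrib mult_ac)
    finally show ?thesis .
  qed
  have "centroid_numerator (fourier_polygon m J c) =
      (\<Sum>k<m. (p k + p (Suc k)) * complex_of_real (Im (cnj (p k) * p (Suc k))))"
    by (simp add: centroid_numerator_def index_fourier_polygon unity_root_power_mod p_def u_def del: power_Suc)
  also have "\<dots> = (\<Sum>a\<in>J. \<Sum>b\<in>J. \<Sum>d\<in>J. \<Sum>k<m.
      c a * c b * cnj (c d) * h a b d * (u (a + b) * cnj (u d)) ^ k)"
    unfolding summand
    by (rule trans[OF sum.swap sum.cong[OF refl trans[OF sum.swap sum.cong[OF refl sum.swap]]]])
  also have "\<dots> = (\<Sum>a\<in>J. \<Sum>b\<in>J. \<Sum>d\<in>J. g a b d * h a b d)"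
    unfolding sum_distrib_left[symmetric] u_def sum_character[OF \<open>m > 0\<close>]
    by (simp add: g_def \<delta>_def mult_ac)
  finally have "centroid_numerator (fourier_polygon m J c) =
      (\<Sum>a\<in>J. \<Sum>b\<in>J. \<Sum>d\<in>J. g a b d * h a b d)" .
  \<comment> \<open>The weight of a triple is only real after averaging over the two orders of \<open>a\<close> and \<open>b\<close>.\<close>
  also have "\<dots> = ((\<Sum>a\<in>J. \<Sum>b\<in>J. \<Sum>d\<in>J. g a b d * h a b d) +
                 (\<Sum>a\<in>J. \<Sum>b\<in>J. \<Sum>d\<in>J. g b a d * h b a d)) / 2"
    by (subst (3) sum.swap) simp
  also have "\<dots> = (\<Sum>a\<in>J. \<Sum>b\<in>J. \<Sum>d\<in>J. (g a b d * h a b d + g b a d * h b a d) / 2)"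
    by (simp only: sum.distrib add_divide_distrib sum_divide_distrib)
  also have "\<dots> = m * (\<Sum>a\<in>J. \<Sum>b\<in>J. \<Sum>d\<in>J. if (a + b) mod m = d mod m
                then c a * c b * cnj (c d) * of_real (\<sigma> d + (\<sigma> a + \<sigma> b) / 2) else 0)"
    unfolding sum_distrib_left
  proof (intro sum.cong refl)
    fix a b d
    show "(g a b d * h a b d + g b a d * h b a d) / 2 =
        m * (if (a + b) mod m = d mod m
             then c a * c b * cnj (c d) * of_real (\<sigma> d + (\<sigma> a + \<sigma> b) / 2) else 0)"
    proof (cases "(a + b) mod m = d mod m")
      case True
      then have ud: "u d = u a * u b"
        using unity_root_eq_iff[OF \<open>m > 0\<close>, of "a + b" d] by (simp add: u_def unity_root_add)
      have sig: "complex_of_real (\<sigma> j) = (u j - inverse (u j)) / (2 * \<i>)" for j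
        using of_real_Im[of "u j"] by (simp add: \<sigma>_def u_def cnj_unity_root Im_unity_root)
      have "(h a b d + h b a d) / 2 = \<sigma> d + (\<sigma> a + \<sigma> b) / 2"
        unfolding of_real_add of_real_divide sig h_def ud
        by (simp add: u_def cnj_unity_root field_simps)
      moreover have "(g a b d * h a b d + g b a d * h b a d) / 2 =
          m * (c a * c b * cnj (c d)) * ((h a b d + h b a d) / 2)"
        using True by (simp add: g_def \<delta>_def add.commute[of b a] algebra_simps add_divide_distrib)
      ultimately show ?thesis
        unfolding if_P[OF True] by (simp only: mult.assoc)
    qed (simp add: g_def \<delta>_def add.commute)
  qed
  finally show ?thesis .
qed (simp add: centroid_numerator_def)

section \<open>The polygon with modes 1, 2 and 3\<close>

lemma midpoint_eigenvalue_polar: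
  "midpoint_eigenvalue m j = cos (pi * real j / real m) * cis (pi * real j / real m)"
proof -
  define t where "t = pi * real j / real m"
  have "unity_root m j = cis (2 * t)"
    by (simp add: unity_root_def t_def mult.assoc)
  moreover have "(1 + cis (2 * t)) / 2 = cos t * cis t"
    by (simp add: complex_eq_iff cos_double_cos sin_double power2_eq_square)
  ultimately show ?thesis
    by (simp add: midpoint_eigenvalue_def t_def)
qed

text \<open>The phases \<open>\<pi> a / m\<close>, \<open>\<pi> b / m\<close> and \<open>- \<pi> (a + b) / m\<close> cancel, so a resonant term keeps its
  direction, up to sign, under the iteration.\<close>

lemma midpoint_eigenvalue_resonance:
  "midpoint_eigenvalue m a * midpoint_eigenvalue m b * cnj (midpoint_eigenvalue m (a + b)) =
   of_real (cos (pi * real a / real m) * cos (pi * real b / real m) * cos (pi * real (a + b) / real m))"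
proof -
  have "cis (pi * real a / real m) * cis (pi * real b / real m) * cnj (cis (pi * real (a + b) / real m)) = 1"
    by (simp add: cis_cnj cis_mult distrib_left add_divide_distrib flip: cis_inverse)
  then show ?thesis
    unfolding midpoint_eigenvalue_polar
    by (simp add: mult_ac)
qed

lemma pentagon_conjugate_modes:
  shows "unity_root 5 3 = cnj (unity_root 5 2)"
    and "midpoint_eigenvalue 5 3 = cnj (midpoint_eigenvalue 5 2)"
proof -
  have "unity_root 5 2 * unity_root 5 3 = unity_root 5 5"
    using unity_root_add[of 5 2 3] by simp
  also have "\<dots> = 1"
    by (simp add: unity_root_def)
  finally show "unity_root 5 3 = cnj (unity_root 5 2)"
    by (simp add: cnj_unity_root field_simps)
  then show "midpoint_eigenvalue 5 3 = cnj (midpoint_eigenvalue 5 2)"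
    by (simp add: midpoint_eigenvalue_def)
qed

text \<open>Since \<open>a + b - d\<close> lies between -1 and 5, a resonance that wraps around needs \<open>m \<le> 5\<close>.\<close>

lemma resonant_triples:
  fixes f :: "nat \<Rightarrow> nat \<Rightarrow> nat \<Rightarrow> complex"
  assumes "m = 5 \<or> m \<ge> 7"
  shows "(\<Sum>a\<in>{1,2,3}. \<Sum>b\<in>{1,2,3}. \<Sum>d\<in>{1,2,3}. if (a + b) mod m = d mod m then f a b d else 0) =
         f 1 1 2 + f 1 2 3 + f 2 1 3 + (if m = 5 then f 3 3 1 else 0)"
  using assms
proof
  assume "m = 5"
  then show ?thesis by simp
next
  assume "m \<ge> 7"
  then show ?thesis by (simp add: mod_less)
qed

text \<open>The coefficient \<open>\<i>\<close> makes the terms of \<open>1 + 1 = 2\<close> and \<open>1 + 2 = 3\<close> perpendicular.\<close>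

definition three_mode_polygon :: "nat \<Rightarrow> complex vec" where
  "three_mode_polygon m = fourier_polygon m {1, 2, 3} (\<lambda>j. if j = 3 then \<i> else 1)"

text \<open>With \<open>x = \<pi> / m\<close>, the multipliers of the two resonances are \<open>(cos x)\<^sup>2 * cos (2 x)\<close> and
  \<open>2 cos (2 x) - 1\<close> times that. These bounds say that both are nonzero and have different moduli.
  The value \<open>cos (2 x) = 1 / 2\<close> is that of the hexagon, whose mode 3 is killed by one midpoint step.\<close>

lemma angle_facts:
  fixes m :: nat
  assumes "m = 5 \<or> m \<ge> 7"
  defines "x \<equiv> pi / real m"
  shows "0 < cos x" and "0 < cos (2 * x)" and "cos (2 * x) < 1" and "cos (2 * x) \<noteq> 1 / 2"
    and "cos (3 * x) = cos x * (2 * cos (2 * x) - 1)"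
proof -
  have m: "real m \<ge> 5" "real m \<noteq> 6"
    using assms(1) by auto
  have "pi / real m \<le> pi / 5"
    by (rule divide_left_mono) (use m(1) in auto)
  then have x: "0 < x" "x \<le> pi / 5"
    unfolding x_def using m(1) by auto
  have pi: "0 < pi"
    by (rule pi_gt_zero)
  show "0 < cos x"
    by (rule cos_gt_zero_pi) (use x pi in linarith)+
  show "0 < cos (2 * x)"
    by (rule cos_gt_zero_pi) (use x pi in linarith)+
  have "cos (2 * x) < cos 0"
    by (rule cos_monotone_0_pi) (use x pi in linarith)+
  then show "cos (2 * x) < 1"
    by simp
  show "cos (2 * x) \<noteq> 1 / 2"
  proof
    assume "cos (2 * x) = 1 / 2"
    then have "cos (2 * x) = cos (pi / 3)"
      by (simp only: cos_60)
    moreover have "0 \<le> 2 * x" "2 * x \<le> pi" "0 \<le> pi / 3" "pi / 3 \<le> pi"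
      using x pi by linarith+
    ultimately have "2 * x = pi / 3"
      by (metis cos_inj_pi)
    then have "real m = 6"
      using m(1) by (simp add: x_def field_simps)
    then show False
      using m(2) by contradiction
  qed
  show "cos (3 * x) = cos x * (2 * cos (2 * x) - 1)"
    unfolding cos_treble_cos cos_double_cos
    by (simp add: power2_eq_square power3_eq_cube algebra_simps)
qed

text \<open>These signs make the area positive, and the weights of the resonances \<open>1 + 1 = 2\<close> and
  \<open>1 + 2 = 3\<close> nonzero. For the pentagon \<open>\<sigma> 3\<close> is negative, and the last weight is still positive
  since \<open>sin (2 \<pi> / 5) > sin (4 \<pi> / 5)\<close>.\<close>

lemma sine_facts:
  fixes m :: nat
  assumes "m = 5 \<or> m \<ge> 7"
  defines "\<sigma> \<equiv> \<lambda>j. sin (2 * pi * real j / real m)"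
  shows "0 < \<sigma> 1" and "0 < \<sigma> 2" and "0 < \<sigma> 1 + \<sigma> 2 + 2 * \<sigma> 3"
    and "m = 5 \<Longrightarrow> \<sigma> 3 = - \<sigma> 2" and "m \<noteq> 5 \<Longrightarrow> 0 < \<sigma> 3"
proof -
  have pos: "0 < \<sigma> j" if "0 < j" "2 * j < m" for j
    unfolding \<sigma>_def
  proof (rule sin_gt_zero)
    show "0 < 2 * pi * real j / real m"
      using that by simp
    have "real (2 * j) < real m"
      using that by linarith
    then have "2 * real j / real m < 1"
      using that by (simp add: field_simps)
    then have "pi * (2 * real j / real m) < pi * 1"
      by (rule mult_strict_left_mono) simp
    then show "2 * pi * real j / real m < pi"
      by (simp add: mult_ac)
  qed
  show s1: "0 < \<sigma> 1" and s2: "0 < \<sigma> 2"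
    using assms(1) by (auto intro!: pos)
  show s3: "\<sigma> 3 = - \<sigma> 2" if "m = 5"
    using pentagon_conjugate_modes(1) that Im_unity_root[of 5 3] Im_unity_root[of 5 2]
    by (simp add: \<sigma>_def)
  show s3': "0 < \<sigma> 3" if "m \<noteq> 5"
    using assms(1) that by (auto intro!: pos)
  show "0 < \<sigma> 1 + \<sigma> 2 + 2 * \<sigma> 3"
  proof (cases "m = 5")
    case True
    have "\<sigma> 2 = sin (pi - pi / 5)"
      by (simp add: \<sigma>_def True field_simps)
    also have "\<dots> = sin (pi / 5)"
      by (rule sin_pi_minus)
    also have "\<dots> < sin (2 * pi / 5)"
      using pi_gt_zero by (intro sin_monotone_2pi) linarith+
    also have "\<dots> = \<sigma> 1"
      by (simp add: \<sigma>_def True)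
    finally show ?thesis
      using s3[OF True] by simp
  next
    case False
    then show ?thesis
      using s1 s2 s3' by simp
  qed
qed

text \<open>The first resonance contributes the real direction, the others the direction \<open>w\<close>, whose
  imaginary part is nonzero. In the pentagon the extra resonance decays at the same rate as
  \<open>1 + 2 = 3\<close> and only adds a real number to \<open>w\<close>.\<close>

lemma centroid_numerator_three_mode:
  fixes m :: nat
  assumes m: "m = 5 \<or> m \<ge> 7"
  defines "x \<equiv> pi / real m" and "\<sigma> \<equiv> \<lambda>j. sin (2 * pi * real j / real m)"
  defines "w \<equiv> (if m = 5 then - of_real (\<sigma> 1 + \<sigma> 3) else 0) - \<i> * of_real (\<sigma> 1 + \<sigma> 2 + 2 * \<sigma> 3)"
  shows "centroid_numerator ((midpoint_map ^^ n) (three_mode_polygon m)) =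
         of_real (m * ((cos x)\<^sup>2 * cos (2 * x)) ^ n) *
         (of_real (\<sigma> 1 + \<sigma> 2) + w * of_real ((2 * cos (2 * x) - 1) ^ n))"
proof -
  define \<gamma> :: "nat \<Rightarrow> complex" where "\<gamma> j = (if j = 3 then \<i> else 1)" for j
  define l where "l = midpoint_eigenvalue m"
  define r s where "r = (cos x)\<^sup>2 * cos (2 * x)" and "s = r * (2 * cos (2 * x) - 1)"
  define f where "f a b d = \<gamma> a * \<gamma> b * cnj (\<gamma> d) * (l a * l b * cnj (l d)) ^ n *
    of_real (\<sigma> d + (\<sigma> a + \<sigma> b) / 2)" for a b d
  have "centroid_numerator ((midpoint_map ^^ n) (three_mode_polygon m)) =
      m * (\<Sum>a\<in>{1,2,3}. \<Sum>b\<in>{1,2,3}. \<Sum>d\<in>{1,2,3}. if (a + b) mod m = d mod m then f a b d else 0)"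
    unfolding three_mode_polygon_def midpoint_iterate_fourier_polygon \<gamma>_def[symmetric] l_def[symmetric]
    by (subst centroid_numerator_fourier_polygon)
       (auto simp only: f_def \<sigma>_def complex_cnj_mult complex_cnj_power power_mult_distrib mult_ac)
  also have "\<dots> = m * (f 1 1 2 + f 1 2 3 + f 2 1 3 + (if m = 5 then f 3 3 1 else 0))"
    unfolding resonant_triples[OF m] ..
  finally have expansion: "centroid_numerator ((midpoint_map ^^ n) (three_mode_polygon m)) =
      m * (f 1 1 2 + f 1 2 3 + f 2 1 3 + (if m = 5 then f 3 3 1 else 0))" .
  have f112: "f 1 1 2 = of_real ((\<sigma> 1 + \<sigma> 2) * r ^ n)"
  proof -
    have "l 1 * l 1 * cnj (l 2) = of_real r"
      using midpoint_eigenvalue_resonance[of m 1 1]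
      by (simp add: l_def r_def x_def power2_eq_square mult_ac numeral_2_eq_2[symmetric])
    then show ?thesis
      by (simp add: f_def \<gamma>_def mult_ac)
  qed
  have l123: "l 1 * l 2 * cnj (l 3) = of_real s"
  proof -
    have "cos x * cos (2 * x) * cos (3 * x) = s"
      unfolding angle_facts(5)[OF m, folded x_def]
      by (simp add: s_def r_def power2_eq_square mult_ac)
    then show ?thesis
      using midpoint_eigenvalue_resonance[of m 1 2]
      by (simp add: l_def x_def mult_ac del: One_nat_def)
  qed
  then have l213: "l 2 * l 1 * cnj (l 3) = of_real s"
    by (simp only: mult.commute[of "l 2"])
  have f123: "f 1 2 3 + f 2 1 3 = - \<i> * of_real ((\<sigma> 1 + \<sigma> 2 + 2 * \<sigma> 3) * s ^ n)"
    unfolding f_def l123 l213 by (simp add: \<gamma>_def field_simps)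
  \<comment> \<open>As \<open>l 3\<close> is the conjugate of \<open>l 2\<close>, the multiplier of this resonance is the conjugate of the real number \<open>s\<close>.\<close>
  have f331: "f 3 3 1 = - of_real ((\<sigma> 1 + \<sigma> 3) * s ^ n)" if "m = 5"
  proof -
    have "l 3 = cnj (l 2)"
      using pentagon_conjugate_modes(2) that by (simp add: l_def)
    then have "l 3 * l 3 * cnj (l 1) = cnj (l 1 * l 2 * cnj (l 3))"
      by (simp add: mult_ac)
    also have "\<dots> = of_real s"
      unfolding l123 by simp
    finally show ?thesis
      by (simp add: f_def \<gamma>_def mult_ac)
  qed
  have bracket: "f 1 1 2 + f 1 2 3 + f 2 1 3 + (if m = 5 then f 3 3 1 else 0) =
      of_real ((\<sigma> 1 + \<sigma> 2) * r ^ n) + w * of_real (s ^ n)"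
    unfolding add.assoc[of "f 1 1 2"] unfolding w_def f112 f123 using f331
    by (auto simp: algebra_simps)
  show ?thesis
    unfolding expansion bracket r_def[symmetric] s_def power_mult_distrib
    by (simp add: algebra_simps)
qed

text \<open>Modes 2 and 3 together contribute a nonnegative area: each of them does if \<open>m \<ge> 7\<close>, and they
  cancel in the pentagon, where they are complex conjugate.\<close>

lemma signed_area_three_mode:
  fixes m :: nat
  assumes m: "m = 5 \<or> m \<ge> 7"
  defines "x \<equiv> pi / real m" and "\<sigma> \<equiv> \<lambda>j. sin (2 * pi * real j / real m)"
  shows "m / 2 * (\<sigma> 1 * ((cos x)\<^sup>2) ^ n) \<le> signed_area ((midpoint_map ^^ n) (three_mode_polygon m))"
proof -
  define \<gamma> :: "nat \<Rightarrow> complex" where "\<gamma> j = (if j = 3 then \<i> else 1)" for j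
  define p where "p j = (cmod (midpoint_eigenvalue m j ^ n))\<^sup>2" for j
  have "signed_area ((midpoint_map ^^ n) (three_mode_polygon m)) =
      m / 2 * (\<Sum>j\<in>{1, 2, 3}. (cmod (\<gamma> j * midpoint_eigenvalue m j ^ n))\<^sup>2 * \<sigma> j)"
    unfolding three_mode_polygon_def midpoint_iterate_fourier_polygon \<gamma>_def[symmetric] \<sigma>_def
    by (rule signed_area_fourier_polygon) (use m in auto)
  also have "(\<Sum>j\<in>{1, 2, 3}. (cmod (\<gamma> j * midpoint_eigenvalue m j ^ n))\<^sup>2 * \<sigma> j) =
      \<sigma> 1 * p 1 + (\<sigma> 2 * p 2 + \<sigma> 3 * p 3)"
    by (simp add: \<gamma>_def p_def norm_mult)
  finally have area: "signed_area ((midpoint_map ^^ n) (three_mode_polygon m)) =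
      m / 2 * (\<sigma> 1 * p 1 + (\<sigma> 2 * p 2 + \<sigma> 3 * p 3))" .
  have "cmod (midpoint_eigenvalue m 1) = \<bar>cos x\<bar>"
    by (simp add: midpoint_eigenvalue_polar x_def norm_mult)
  then have p1: "p 1 = ((cos x)\<^sup>2) ^ n"
    by (simp add: p_def norm_power power_even_abs flip: power_mult) (simp add: mult.commute)
  have "0 \<le> \<sigma> 2 * p 2 + \<sigma> 3 * p 3"
  proof (cases "m = 5")
    case True
    then have "p 3 = p 2"
      using pentagon_conjugate_modes(2) by (simp add: p_def norm_power)
    then show ?thesis
      using sine_facts(4)[OF m True] by (simp add: \<sigma>_def)
  next
    case False
    then show ?thesis
      using sine_facts(2,5)[OF m] by (simp add: \<sigma>_def p_def)
  qed
  then show ?thesis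
    unfolding area p1 by (intro mult_left_mono) auto
qed

section \<open>Collinearity with the limit\<close>

text \<open>Two such points on a line through 0 are real multiples of each other. Comparing the imaginary
  parts, the multiple of the brackets is \<open>\<mu> ^ j / \<mu> ^ i\<close>; comparing the real parts, it is then 1.\<close>

lemma not_collinear_perturbed_ray:
  fixes \<kappa> \<mu> \<rho>\<^sub>1 \<rho>\<^sub>2 :: real and w :: complex
  assumes "\<kappa> \<noteq> 0" and "Im w \<noteq> 0" and "\<rho>\<^sub>1 \<noteq> 0" "\<rho>\<^sub>2 \<noteq> 0" and "0 < \<bar>\<mu>\<bar>" "\<bar>\<mu>\<bar> < 1" and "i \<noteq> j"
  shows "\<not> collinear {of_real \<rho>\<^sub>1 * (\<kappa> + w * of_real (\<mu> ^ i)), of_real \<rho>\<^sub>2 * (\<kappa> + w * of_real (\<mu> ^ j)), 0}"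
proof
  define z where "z n = \<kappa> + w * of_real (\<mu> ^ n)" for n
  have re: "Re (z n) = \<kappa> + Re w * \<mu> ^ n" and im: "Im (z n) = Im w * \<mu> ^ n" for n
    by (simp_all add: z_def Re_power_real Im_power_real flip: of_real_power)
  have nz: "z n \<noteq> 0" for n
    using im[of n] assms(2,5) by auto
  assume "collinear {of_real \<rho>\<^sub>1 * (\<kappa> + w * of_real (\<mu> ^ i)), of_real \<rho>\<^sub>2 * (\<kappa> + w * of_real (\<mu> ^ j)), 0}"
  then have "collinear {\<rho>\<^sub>1 *\<^sub>R z i, \<rho>\<^sub>2 *\<^sub>R z j, 0}"
    by (simp only: z_def scaleR_conv_of_real)
  then have "collinear {0, \<rho>\<^sub>1 *\<^sub>R z i, \<rho>\<^sub>2 *\<^sub>R z j}"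
    by (simp add: insert_commute)
  then have "collinear {0, z i, z j}"
    using assms(3,4) by (simp add: collinear_scaleR_iff)
  then obtain t where t: "z j = t *\<^sub>R z i"
    using nz by (auto simp: collinear_lemma)
  have "Im w * \<mu> ^ j = t * (Im w * \<mu> ^ i)"
    using arg_cong[OF t, of Im] by (simp add: im)
  then have \<mu>: "\<mu> ^ j = t * \<mu> ^ i"
    using assms(2) by simp
  have "\<kappa> + Re w * \<mu> ^ j = t * (\<kappa> + Re w * \<mu> ^ i)"
    using arg_cong[OF t, of Re] by (simp add: re)
  then have "t = 1"
    using assms(1) by (simp add: \<mu> algebra_simps)
  then have "\<bar>\<mu>\<bar> ^ j = \<bar>\<mu>\<bar> ^ i"
    using \<mu> by (simp flip: power_abs)
  then show False
    using assms(5-7) power_strict_decreasing[of i j "\<bar>\<mu>\<bar>"] power_strict_decreasing[of j i "\<bar>\<mu>\<bar>"]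
    by (cases i j rule: linorder_cases) auto
qed

text \<open>Lines are closed, so the limit of a sequence that is eventually on a line belongs to that line.\<close>

lemma collinear_tail_limit:
  fixes G :: "nat \<Rightarrow> 'a :: euclidean_space"
  assumes "collinear (G ` {N..})" and "G \<longlonglongrightarrow> L"
  shows "collinear {G N, G (Suc N), L}"
proof -
  have hull: "G n \<in> affine hull (G ` {N..})" if "n \<ge> N" for n
    using that by (intro hull_inc) auto
  have "L \<in> affine hull (G ` {N..})"
  proof (rule Lim_in_closed_set[OF closed_affine_hull _ _ assms(2)])
    show "eventually (\<lambda>n. G n \<in> affine hull (G ` {N..})) sequentially"
      using hull eventually_ge_at_top by (rule eventually_mono[rotated])
  qed simp
  then have "{G N, G (Suc N), L} \<subseteq> affine hull (G ` {N..})"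
    using hull by simp
  moreover have "collinear (affine hull (G ` {N..}))"
    using assms(1) by (simp add: collinear_affine_hull_collinear)
  ultimately show ?thesis
    by (rule collinear_subset[rotated])
qed

text \<open>The centroid is a positive multiple of \<open>\<kappa> + w * \<mu> ^ n\<close> with \<open>\<mu> = 2 cos (2 x) - 1\<close>: the bracket
  is a ray perturbed in an independent direction, and the positive factor, which tends to 0, does
  not affect collinearity with 0.\<close>

proposition centroid_three_mode:
  fixes m :: nat
  assumes m: "m = 5 \<or> m \<ge> 7"
  defines "G \<equiv> \<lambda>n. centroid ((midpoint_map ^^ n) (three_mode_polygon m))"
  shows "signed_area ((midpoint_map ^^ n) (three_mode_polygon m)) > 0"
    and "G \<longlonglongrightarrow> 0"
    and "i \<noteq> j \<Longrightarrow> \<not> collinear {G i, G j, 0}"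
proof -
  define x where "x = pi / real m"
  define \<sigma> where "\<sigma> j = sin (2 * pi * real j / real m)" for j
  define q \<mu> where "q = cos (2 * x)" and "\<mu> = 2 * q - 1"
  define \<kappa> where "\<kappa> = \<sigma> 1 + \<sigma> 2"
  define w where "w = (if m = 5 then - of_real (\<sigma> 1 + \<sigma> 3) else 0) - \<i> * of_real (\<sigma> 1 + \<sigma> 2 + 2 * \<sigma> 3)"
  define A where "A n = signed_area ((midpoint_map ^^ n) (three_mode_polygon m))" for n
  define \<rho> where "\<rho> n = m * ((cos x)\<^sup>2 * q) ^ n / (6 * A n)" for n
  have cos_x: "0 < cos x" and q: "0 < q" "q < 1" and "q \<noteq> 1 / 2"
    using angle_facts[OF m] by (simp_all add: q_def x_def)
  then have \<mu>: "0 < \<bar>\<mu>\<bar>" "\<bar>\<mu>\<bar> < 1"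
    by (auto simp: \<mu>_def)
  have \<sigma>1: "0 < \<sigma> 1" and "0 < \<sigma> 2" and \<sigma>123: "0 < \<sigma> 1 + \<sigma> 2 + 2 * \<sigma> 3"
    using sine_facts[OF m] by (simp_all add: \<sigma>_def)
  then have \<kappa>: "\<kappa> > 0"
    by (simp add: \<kappa>_def)
  have w: "Im w \<noteq> 0"
    using \<sigma>123 by (simp add: w_def)
  have m0: "real m > 0"
    using m by auto
  have A_ge: "m / 2 * (\<sigma> 1 * ((cos x)\<^sup>2) ^ n) \<le> A n" for n
    using signed_area_three_mode[OF m, of n] by (simp add: A_def \<sigma>_def x_def)
  have bound_pos: "0 < m / 2 * (\<sigma> 1 * ((cos x)\<^sup>2) ^ n)" for n
    using m0 \<sigma>1 cos_x by simp
  have A_pos: "A n > 0" for n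
    using bound_pos A_ge by (rule less_le_trans)
  then show "signed_area ((midpoint_map ^^ n) (three_mode_polygon m)) > 0"
    by (simp add: A_def)
  have G: "G n = of_real (\<rho> n) * (\<kappa> + w * of_real (\<mu> ^ n))" for n
    unfolding G_def centroid_def centroid_numerator_three_mode[OF m]
    unfolding \<sigma>_def[symmetric] x_def[symmetric] unfolding w_def[symmetric] q_def[symmetric]
    unfolding \<kappa>_def[symmetric] \<mu>_def[symmetric] A_def[symmetric] \<rho>_def
    by simp
  have \<rho>_pos: "\<rho> n > 0" for n
    using m0 cos_x q A_pos by (simp add: \<rho>_def)
  show "\<not> collinear {G i, G j, 0}" if "i \<noteq> j"
    unfolding G using \<kappa> w \<mu> \<rho>_pos[of i] \<rho>_pos[of j] that
    by (intro not_collinear_perturbed_ray) auto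
  have \<rho>_le: "\<rho> n \<le> q ^ n / (3 * \<sigma> 1)" for n
  proof -
    have "\<rho> n \<le> m * ((cos x)\<^sup>2 * q) ^ n / (6 * (m / 2 * (\<sigma> 1 * ((cos x)\<^sup>2) ^ n)))"
      unfolding \<rho>_def using A_ge[of n] bound_pos[of n] A_pos[of n] q m0
      by (intro divide_left_mono mult_left_mono) auto
    also have "\<dots> = q ^ n / (3 * \<sigma> 1)"
      using m0 cos_x by (simp add: power_mult_distrib)
    finally show ?thesis .
  qed
  have norm_G: "norm (G n) \<le> q ^ n * ((\<kappa> + cmod w) / (3 * \<sigma> 1))" for n
  proof -
    have "cmod (\<kappa> + w * of_real (\<mu> ^ n)) \<le> \<bar>\<kappa>\<bar> + cmod w * \<bar>\<mu>\<bar> ^ n"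
      by (rule order_trans[OF norm_triangle_ineq]) (simp add: norm_mult norm_power)
    also have "\<dots> \<le> \<kappa> + cmod w"
      using \<kappa> \<mu> by (simp add: mult_left_le power_le_one)
    finally have "norm (G n) \<le> \<rho> n * (\<kappa> + cmod w)"
      unfolding G norm_mult using \<rho>_pos[of n] by (simp add: mult_left_mono)
    also have "\<dots> \<le> q ^ n / (3 * \<sigma> 1) * (\<kappa> + cmod w)"
      using \<kappa> by (intro mult_right_mono \<rho>_le) simp
    finally show ?thesis
      by simp
  qed
  show "G \<longlonglongrightarrow> 0"
  proof (rule Lim_null_comparison)
    show "eventually (\<lambda>n. norm (G n) \<le> q ^ n * ((\<kappa> + cmod w) / (3 * \<sigma> 1))) sequentially"
      using norm_G by simp
    show "(\<lambda>n. q ^ n * ((\<kappa> + cmod w) / (3 * \<sigma> 1))) \<longlonglongrightarrow> 0"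
      using q by (intro tendsto_mult_left_zero LIMSEQ_power_zero) simp
  qed
qed

theorem proposition4:
  shows "(\<forall>m\<in>{1, 2, 3, 4::nat}. \<forall>v\<in>carrier_vec m. \<forall>n\<ge>1.
            (signed_area ((midpoint_map ^^ n) v) = 0 \<longleftrightarrow> signed_area (midpoint_map v) = 0) \<and>
            centroid ((midpoint_map ^^ n) v) = centroid (midpoint_map v)) \<and>
         (\<forall>m::nat. m = 5 \<or> m \<ge> 7 \<longrightarrow>
            (\<exists>v\<in>carrier_vec m.
               (\<forall>n. signed_area ((midpoint_map ^^ n) v) \<noteq> 0) \<and>
               (\<exists>L. (\<lambda>n. centroid ((midpoint_map ^^ n) v)) \<longlonglongrightarrow> L \<and>
                  (\<forall>i j. i \<noteq> j \<longrightarrow>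
                     \<not> collinear {centroid ((midpoint_map ^^ i) v),
                                  centroid ((midpoint_map ^^ j) v), L})) \<and>
               \<not> (\<exists>N. collinear ((\<lambda>n. centroid ((midpoint_map ^^ n) v)) ` {N..}))))"
proof (rule conjI, goal_cases)
  case 1
  show ?case
    by (intro ballI allI impI) (rule centroid_invariant_le_4)
next
  case 2
  show ?case
  proof (intro allI impI)
    fix m :: nat assume m: "m = 5 \<or> m \<ge> 7"
    let ?v = "three_mode_polygon m"
    let ?G = "\<lambda>n. centroid ((midpoint_map ^^ n) ?v)"
    have carrier: "?v \<in> carrier_vec m"
      by (rule carrier_vecI) (simp add: three_mode_polygon_def)
    have area: "\<forall>n. signed_area ((midpoint_map ^^ n) ?v) \<noteq> 0"
      by (intro allI less_imp_neq[THEN not_sym] centroid_three_mode(1)[OF m])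
    have lim: "?G \<longlonglongrightarrow> 0"
      by (rule centroid_three_mode(2)[OF m])
    have off_line: "\<not> collinear {?G i, ?G j, 0}" if "i \<noteq> j" for i j
      by (rule centroid_three_mode(3)[OF m that])
    have tail: "\<not> (\<exists>N. collinear (?G ` {N..}))"
    proof
      assume "\<exists>N. collinear (?G ` {N..})"
      then obtain N where "collinear (?G ` {N..})" ..
      then have "collinear {?G N, ?G (Suc N), 0}"
        using lim by (rule collinear_tail_limit)
      with off_line[OF n_not_Suc_n] show False
        by (rule notE)
    qed
    have "\<exists>L. ?G \<longlonglongrightarrow> L \<and> (\<forall>i j. i \<noteq> j \<longrightarrow> \<not> collinear {?G i, ?G j, L})"
      using lim off_line by (intro exI[of _ 0] conjI allI impI)
    with area tail show "\<exists>v\<in>carrier_vec m.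
        (\<forall>n. signed_area ((midpoint_map ^^ n) v) \<noteq> 0) \<and>
        (\<exists>L. (\<lambda>n. centroid ((midpoint_map ^^ n) v)) \<longlonglongrightarrow> L \<and>
           (\<forall>i j. i \<noteq> j \<longrightarrow> \<not> collinear {centroid ((midpoint_map ^^ i) v),
                                  centroid ((midpoint_map ^^ j) v), L})) \<and>
        \<not> (\<exists>N. collinear ((\<lambda>n. centroid ((midpoint_map ^^ n) v)) ` {N..}))"
      by (intro bexI[OF _ carrier] conjI)
  qed
qed

end
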